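(* There is a universal constant $c>0$ such that the following holds. Fix $L,\sigma,b_0,\eta>0$. For every sufficiently large integer $T$, there exist a convex $L$-smooth function $f_T:\mathbb R\to\mathbb R$ with minimum value $f_T^\star=0$ attained at $x^\star=0$, and an oracle $g_t=f_T'(x_t)+\xi_t$, $t\ge1$, satisfying for all $t\ge1$ $$\mathbb E[g_t\mid\mathcal F_{t-1}]=f_T'(x_t),\qquad \mathbb E\big[\exp(\xi_t^2/\sigma^2)\,\big|\,\mathcal F_{t-1}\big]\le e,$$ such that both AdaGrad-Norm and AdaGrad, run with parameters $b_0,\eta$ and initialized at $x_1=x^\star=0$, satisfy $$\mathbb E[f_T(\bar x_T)-f_T^\star]\ge c\,\eta\,\sigma\,\frac{\log T}{\sqrt T}.$$ The objective and oracle may depend on $T$, but $L,\sigma,b_0,\eta$ do not. No horizon-independent bound on the radius of the iterates is assumed.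
   Context: A differentiable function $f:\mathbb R\to\mathbb R$ is $L$-smooth if $|f'(x)-f'(y)|\le L|x-y|$ for all $x,y$. The uniform average is $\bar x_T=\frac1T\sum_{t=1}^T x_t$. Oracle and filtration: at each time $t\ge1$, queried at $x_t$, the oracle returns a random $g_t=f_T'(x_t)+\xi_t$; the law of $g_t$ may depend on time and on the past (in particular on $x_t$). The initialization $x_1$ is deterministic, $\mathcal F_0$ is trivial, and $\mathcal F_t=\sigma(g_1,\dots,g_t)$, so $x_t$ is $\mathcal F_{t-1}$-measurable. Algorithms (dimension one): $b_t^2=b_0^2+\sum_{s=1}^t g_s^2$ with $b_t>0$, and $x_{t+1}=x_t-\eta\, g_t/b_t$ for $t\ge1$. This is the AdaGrad-Norm update in dimension one; coordinate-wise AdaGrad (with its single initial accumulator $b_{0,1}=b_0$) is the same recursion in dimension one, so the two algorithms have the same trajectory. For each $T$, the trajectory is the one generated on the instance $f_T$ and its oracle. "Universal" means that $c$ is an absolute constant, independent of $L,\sigma,b_0,\eta,T$. *)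

theory Defs
  imports "HOL-Probability.Probability"
begin

definition L_smooth :: "real \<Rightarrow> (real \<Rightarrow> real) \<Rightarrow> bool" where
  "L_smooth L f \<longleftrightarrow>
     (\<forall>x. f differentiable (at x)) \<and>
     (\<forall>x y. \<bar>deriv f x - deriv f y\<bar> \<le> L * \<bar>x - y\<bar>)"

text \<open>
  Both algorithms are defined in arbitrary finite dimension and are used at type \<^typ>\<open>real\<close>
  (where \<open>Basis = {1}\<close>) in the statement. A gradient sequence \<open>g\<close> and an iterate sequence are
  indexed from \<open>1\<close> as in the mathematics. The iterate with index \<open>0\<close> is a dummy value, and
  \<open>g 0\<close> is never used.
\<close>

definition norm_accumulator :: "real \<Rightarrow> (nat \<Rightarrow> 'a::euclidean_space) \<Rightarrow> nat \<Rightarrow> real" where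
  "norm_accumulator b0 g t = sqrt (b0\<^sup>2 + (\<Sum>s=1..t. (norm (g s))\<^sup>2))"

primrec adagrad_norm ::
  "real \<Rightarrow> real \<Rightarrow> 'a::euclidean_space \<Rightarrow> (nat \<Rightarrow> 'a) \<Rightarrow> nat \<Rightarrow> 'a" where
  "adagrad_norm b0 \<eta> x1 g 0 = x1"
| "adagrad_norm b0 \<eta> x1 g (Suc t) =
     (if t = 0 then x1
      else adagrad_norm b0 \<eta> x1 g t - (\<eta> / norm_accumulator b0 g t) *\<^sub>R g t)"

definition coord_accumulator ::
  "('a \<Rightarrow> real) \<Rightarrow> (nat \<Rightarrow> 'a::euclidean_space) \<Rightarrow> 'a \<Rightarrow> nat \<Rightarrow> real" where
  "coord_accumulator b0 g i t = sqrt ((b0 i)\<^sup>2 + (\<Sum>s=1..t. (g s \<bullet> i)\<^sup>2))"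

primrec adagrad ::
  "('a \<Rightarrow> real) \<Rightarrow> real \<Rightarrow> 'a::euclidean_space \<Rightarrow> (nat \<Rightarrow> 'a) \<Rightarrow> nat \<Rightarrow> 'a" where
  "adagrad b0 \<eta> x1 g 0 = x1"
| "adagrad b0 \<eta> x1 g (Suc t) =
     (if t = 0 then x1
      else adagrad b0 \<eta> x1 g t
        - (\<Sum>i\<in>Basis. (\<eta> * (g t \<bullet> i) / coord_accumulator b0 g i t) *\<^sub>R i))"

definition uniform_average :: "(nat \<Rightarrow> 'a::real_vector) \<Rightarrow> nat \<Rightarrow> 'a" where
  "uniform_average x T = (1 / real T) *\<^sub>R (\<Sum>t=1..T. x t)"

text \<open>The sigma-algebra generated by \<open>g 1, \<dots>, g t\<close>; it is trivial for \<open>t = 0\<close>.\<close>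

definition gradient_filtration ::
  "'w measure \<Rightarrow> (nat \<Rightarrow> 'w \<Rightarrow> real) \<Rightarrow> nat \<Rightarrow> 'w measure" where
  "gradient_filtration M g t =
     sigma (space M) (\<Union>s\<in>{1..t}. {g s -` A \<inter> space M | A. A \<in> sets borel})"

text \<open>
  \<open>x\<close> is the query process and \<open>g\<close> the process of the oracle's answers; the noise is
  \<open>\<xi> t = g t - f' (x t)\<close>. Integrability of \<open>g t\<close> is required because \<open>real_cond_exp\<close> is the
  conditional expectation only of integrable functions. The exponential moment is conditioned as
  a nonnegative extended real function, so a bound on it also asserts that it is finite.
\<close>

definition subgaussian_oracle ::
  "'w measure \<Rightarrow> (real \<Rightarrow> real) \<Rightarrow> real \<Rightarrow> (nat \<Rightarrow> 'w \<Rightarrow> real) \<Rightarrow> (nat \<Rightarrow> 'w \<Rightarrow> real) \<Rightarrow> bool" where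
  "subgaussian_oracle M f \<sigma> x g \<longleftrightarrow>
     (\<forall>t\<ge>1.
        g t \<in> borel_measurable M \<and> integrable M (g t) \<and>
        (AE \<omega> in M.
           real_cond_exp M (gradient_filtration M g (t - 1)) (g t) \<omega> = deriv f (x t \<omega>)) \<and>
        (AE \<omega> in M.
           nn_cond_exp M (gradient_filtration M g (t - 1))
             (\<lambda>\<omega>'. ennreal (exp ((g t \<omega>' - deriv f (x t \<omega>'))\<^sup>2 / \<sigma>\<^sup>2))) \<omega> \<le> ennreal (exp 1)))"

end

theory Submission
  imports Defs
begin

text \<open>
  The mechanism is a random walk in a nearly flat parabola. While the noise has a fixed size
  \<open>s = \<sigma> / 2\<close>, AdaGrad moves by about \<open>\<eta> / sqrt t\<close> at time \<open>t\<close> in a random direction. The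
  squared steps sum up like a harmonic series, so a free walk has second moment of order
  \<open>\<eta>\<^sup>2 ln t\<close>. The objective \<open>f y = \<epsilon> / 2 * y\<^sup>2\<close> with \<open>\<epsilon> = \<sigma> / (16 * \<eta> * sqrt T)\<close> pulls the walk
  back by the factor \<open>1 - \<eta> \<epsilon> / b\<^sub>t\<close>, where \<open>b\<^sub>t \<ge> s * sqrt t\<close>. This choice of \<open>\<epsilon>\<close> makes the sum of
  \<open>\<eta> \<epsilon> / b\<^sub>t\<close> over the horizon at most \<open>1 / 4\<close>, so that the pull costs only constant factors. The
  walk therefore stays at squared distance of order \<open>\<eta>\<^sup>2 ln T\<close>, and the gap is of order
  \<open>\<epsilon> * \<eta>\<^sup>2 * ln T = \<eta> * \<sigma> * ln T / (16 * sqrt T)\<close>.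
\<close>

text \<open>
  In general \<open>b\<^sub>t\<close> is random and correlated with the iterates. It becomes deterministic if the answer
  is always \<open>s\<close> or \<open>- s\<close>: the required conditional mean \<open>\<epsilon> * x\<^sub>t\<close> is produced by biasing the coin.
  This is possible as long as \<open>\<bar>\<epsilon> * x\<^sub>t\<bar> \<le> s\<close>, which holds on every path up to the horizon because the
  steps are at most \<open>\<eta> / sqrt t\<close> (\<open>horizon_deterministic\<close>). After the horizon the answer may become
  noiseless. The coins are driven by independent uniform variables, and redrawing the variable of
  time \<open>t\<close> changes nothing that happened earlier, which identifies the conditional expectation
  (\<open>integral_mult_answer\<close>).
\<close>

text \<open>
  With a deterministic \<open>b\<^sub>t\<close> the products \<open>E (x\<^sub>r * x\<^sub>t)\<close> satisfy linear recursions
  (\<open>correlation_Suc\<close>, \<open>second_moment_Suc\<close>). They give \<open>E x\<^sub>m\<^sup>2 \<ge> \<eta>\<^sup>2 * ln T / 4\<close> for the middle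
  time \<open>m\<close> and show that later iterates remember \<open>x\<^sub>m\<close>: \<open>E (x\<^sub>m * x\<^sub>t) \<ge> 3 / 4 * E x\<^sub>m\<^sup>2\<close>. Since at least
  half of the iterates come from time \<open>m\<close> on, averaging does not cancel the displacement
  (\<open>average_second_moment_ge\<close>).
\<close>

section \<open>The trajectory as a function of the gradients\<close>

lemma adagrad_eq_adagrad_norm:
  "adagrad (\<lambda>_. b0) \<eta> x1 (g :: nat \<Rightarrow> real) = adagrad_norm b0 \<eta> x1 g"
proof
  fix t
  show "adagrad (\<lambda>_. b0) \<eta> x1 g t = adagrad_norm b0 \<eta> x1 g t"
    by (induction t) (auto simp: coord_accumulator_def norm_accumulator_def)
qed

lemma norm_accumulator_pos: "0 < b0 \<Longrightarrow> 0 < norm_accumulator b0 g t"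
  unfolding norm_accumulator_def by (intro real_sqrt_gt_zero add_pos_nonneg sum_nonneg) auto

lemma adagrad_norm_cong:
  assumes "\<And>r. r < t \<Longrightarrow> g r = h r"
  shows "adagrad_norm b0 \<eta> x1 g t = adagrad_norm b0 \<eta> x1 h t"
  using assms
proof (induction t)
  case (Suc t)
  have "norm_accumulator b0 g t = norm_accumulator b0 h t"
    unfolding norm_accumulator_def using Suc.prems by (intro arg_cong[of _ _ sqrt]) auto
  with Suc show ?case by simp
qed simp

lemma adagrad_norm_measurable:
  fixes g :: "nat \<Rightarrow> 'w \<Rightarrow> real"
  assumes "\<And>r. 1 \<le> r \<Longrightarrow> r < t \<Longrightarrow> g r \<in> borel_measurable M"
  shows "(\<lambda>w. adagrad_norm b0 \<eta> x1 (\<lambda>r. g r w) t) \<in> borel_measurable M"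
  using assms
proof (induction t)
  case (Suc t)
  have [measurable]: "(\<lambda>w. adagrad_norm b0 \<eta> x1 (\<lambda>r. g r w) t) \<in> borel_measurable M"
    using Suc by auto
  show ?case
  proof (cases "t = 0")
    case False
    have [measurable]: "g t \<in> borel_measurable M"
      using False Suc.prems by auto
    have "(\<lambda>w. \<Sum>r = 1..t. (norm (g r w))\<^sup>2) \<in> borel_measurable M"
      using Suc.prems by (intro borel_measurable_sum borel_measurable_power borel_measurable_norm
        measurable_compose[OF _ borel_measurable_norm]) auto
    then have [measurable]: "(\<lambda>w. norm_accumulator b0 (\<lambda>r. g r w) t) \<in> borel_measurable M"
      unfolding norm_accumulator_def by measurable
    show ?thesis using False by simp
  qed simp
qed simp

section \<open>The filtration generated by the gradients\<close>

lemma gradient_filtration_sets: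
  "sets (gradient_filtration M g t) = 
     sigma_sets (space M) (\<Union>s\<in>{1..t}. {g s -` A \<inter> space M | A. A \<in> sets borel})"
  "space (gradient_filtration M g t) = space M"
  unfolding gradient_filtration_def by (auto intro!: sets_measure_of space_measure_of)

lemma gradient_filtration_measurable:
  assumes "1 \<le> s" "s \<le> t"
  shows "g s \<in> borel_measurable (gradient_filtration M g t)"
proof (rule measurableI)
  fix A :: "real set" assume "A \<in> sets borel"
  then show "g s -` A \<inter> space (gradient_filtration M g t) \<in> sets (gradient_filtration M g t)"
    unfolding gradient_filtration_sets using assms by (intro sigma_sets.Basic UN_I[of s]) auto
qed simp

lemma subalgebra_gradient_filtration:
  assumes "\<And>s. 1 \<le> s \<Longrightarrow> s \<le> t \<Longrightarrow> g s \<in> borel_measurable M"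
  shows "subalgebra M (gradient_filtration M g t)"
  unfolding subalgebra_def gradient_filtration_sets
  using assms by (auto intro!: sets.sigma_sets_subset measurable_sets)

text \<open>
  An event of the past cannot separate two sample points with the same past. This property passes
  to complements and countable unions, so it is enough to have it for the generators.
\<close>

lemma gradient_filtration_invariant:
  assumes "A \<in> sets (gradient_filtration M g t)"
    and "\<And>s. 1 \<le> s \<Longrightarrow> s \<le> t \<Longrightarrow> g s w = g s w'"
    and "w \<in> space M" "w' \<in> space M"
  shows "w \<in> A \<longleftrightarrow> w' \<in> A"
  using assms(1) unfolding gradient_filtration_sets
proof (induction rule: sigma_sets.induct)
  case (Basic a)
  then show ?case using assms(2-4) by auto
qed (use assms(3,4) in auto)

section \<open>Independent uniform variables and biased coins\<close>

definition uniform01 :: "real measure" where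
  "uniform01 = uniform_measure lborel {0..1}"

definition uniform_sequence :: "(nat \<Rightarrow> real) measure" where
  "uniform_sequence = PiM UNIV (\<lambda>_. uniform01)"

lemma sets_uniform01 [measurable_cong, simp]: "sets uniform01 = sets borel"
  by (simp add: uniform01_def)

lemma space_uniform01 [simp]: "space uniform01 = UNIV"
  by (simp add: uniform01_def)

lemma prob_space_uniform01: "prob_space uniform01"
  unfolding uniform01_def by (rule prob_space_uniform_measure) auto

lemma prob_space_uniform_sequence: "prob_space uniform_sequence"
  unfolding uniform_sequence_def by (intro prob_space_PiM prob_space_uniform01)

lemma space_uniform_sequence [simp]: "space uniform_sequence = UNIV"
  by (simp add: uniform_sequence_def space_PiM)

lemma measurable_component_uniform_sequence [measurable]:
  "(\<lambda>w. w t) \<in> borel_measurable uniform_sequence"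
proof -
  have "(\<lambda>w. w t) \<in> measurable uniform_sequence uniform01"
    unfolding uniform_sequence_def by (rule measurable_component_singleton) simp
  then show ?thesis by (simp cong: measurable_cong_sets)
qed

text \<open>
  Replacing one coordinate of an independent sequence by a fresh copy leaves the law unchanged. In
  this form independence needs no splitting of the sequence into past, present and future.
\<close>

lemma integral_resample:
  fixes h :: "(nat \<Rightarrow> real) \<Rightarrow> real"
  assumes [measurable]: "h \<in> borel_measurable uniform_sequence"
    and bounded: "\<And>w. \<bar>h w\<bar> \<le> B"
  shows "(\<integral>w. h w \<partial>uniform_sequence) =
    (\<integral>w. (\<integral>u. h (w(t := u)) \<partial>uniform01) \<partial>uniform_sequence)"
proof -
  interpret U: prob_space uniform01 by (rule prob_space_uniform01)
  interpret S: prob_space uniform_sequence by (rule prob_space_uniform_sequence)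
  interpret P: pair_prob_space uniform01 uniform_sequence ..
  let ?P = "uniform01 \<Otimes>\<^sub>M uniform_sequence"
  have upd [measurable]: "(\<lambda>(u, w). w(t := u)) \<in> measurable ?P uniform_sequence"
    unfolding uniform_sequence_def case_prod_beta'
    by (rule measurable_fun_upd[where J = UNIV]) auto
  have eq: "distr ?P uniform_sequence (\<lambda>(u, w). w(t := u)) = uniform_sequence"
    unfolding uniform_sequence_def
    using distr_pair_PiM_eq_PiM[of UNIV "\<lambda>_. uniform01" t] prob_space_uniform01 by simp
  have int: "integrable ?P (\<lambda>(u, w). h (w(t := u)))"
    by (rule P.integrable_const_bound[where B = B]) (auto simp: bounded)
  have "(\<integral>w. h w \<partial>uniform_sequence) =
      (\<integral>w. h w \<partial>distr ?P uniform_sequence (\<lambda>(u, w). w(t := u)))"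
    by (simp only: eq)
  also have "\<dots> = (\<integral>z. (case z of (u, w) \<Rightarrow> h (w(t := u))) \<partial>?P)"
    by (subst integral_distr) (auto simp: case_prod_beta')
  also have "\<dots> = (\<integral>w. (\<integral>u. h (w(t := u)) \<partial>uniform01) \<partial>uniform_sequence)"
    using P.integral_snd[OF int] by simp
  finally show ?thesis .
qed

text \<open>
  For a uniform \<open>u\<close> this is the \<open>\<plusminus>s\<close>-valued coin of mean \<open>\<mu>\<close>. Such a coin exists only for
  \<open>\<bar>\<mu>\<bar> \<le> s\<close>. Otherwise the value is the constant \<open>\<mu>\<close>, which still has the right mean and no noise.
\<close>

definition coin :: "real \<Rightarrow> real \<Rightarrow> real \<Rightarrow> real" where
  "coin s \<mu> u = (if \<bar>\<mu>\<bar> \<le> s then if u \<le> (1 + \<mu> / s) / 2 then s else - s else \<mu>)"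

lemma coin_abs_le: "0 < s \<Longrightarrow> \<bar>coin s \<mu> u\<bar> \<le> s + \<bar>\<mu>\<bar>"
  by (auto simp: coin_def)

lemma coin_noise_le: "0 < s \<Longrightarrow> \<bar>coin s \<mu> u - \<mu>\<bar> \<le> 2 * s"
  by (auto simp: coin_def)

lemma coin_square: "\<bar>\<mu>\<bar> \<le> s \<Longrightarrow> (coin s \<mu> u)\<^sup>2 = s\<^sup>2"
  by (auto simp: coin_def)

lemma coin_measurable [measurable]:
  assumes [measurable]: "f \<in> borel_measurable M" "h \<in> borel_measurable M"
  shows "(\<lambda>w. coin s (f w) (h w)) \<in> borel_measurable M"
  unfolding coin_def by measurable

lemma coin_mean:
  assumes s: "0 < s"
  shows "(\<integral>u. coin s \<mu> u \<partial>uniform01) = \<mu>"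
proof -
  interpret U: prob_space uniform01 by (rule prob_space_uniform01)
  show ?thesis
  proof (cases "\<bar>\<mu>\<bar> \<le> s")
    case True
    define p where "p = (1 + \<mu> / s) / 2"
    have p: "0 \<le> p" "p \<le> 1" "s * (2 * p - 1) = \<mu>"
      using True s by (auto simp: p_def field_simps)
    have "coin s \<mu> u = 2 * s * indicator {..p} u - s" for u
      using True by (auto simp: coin_def p_def)
    moreover have "integrable uniform01 (\<lambda>u. 2 * s * indicator {..p} u)"
      by (intro integrable_mult_right integrable_real_indicator)
        (auto simp: less_top[symmetric])
    ultimately have "(\<integral>u. coin s \<mu> u \<partial>uniform01) = 2 * s * measure uniform01 {..p} - s"
      using U.prob_space by simp
    also have "measure uniform01 {..p} = p"
    proof -
      have "{0..1} \<inter> {..p} = {0..p}" using p by auto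
      then show ?thesis
        unfolding uniform01_def using p by (subst measure_uniform_measure) auto
    qed
    finally show ?thesis using p by (simp add: algebra_simps)
  qed (use U.prob_space in \<open>simp add: coin_def\<close>)
qed

section \<open>Elementary estimates\<close>

lemma two_sqrt_step: "2 * sqrt (real n) + 1 / sqrt (real (Suc n)) \<le> 2 * sqrt (real (Suc n))"
proof -
  let ?a = "sqrt (real n)" and ?b = "sqrt (real (Suc n))"
  have b: "0 < ?b" and sq: "?a * ?a = real n" "?b * ?b = real n + 1" by auto
  have "0 \<le> (?a - ?b)\<^sup>2" by simp
  then have "2 * ?a * ?b \<le> 2 * (?b * ?b) - 1"
    using sq by (simp add: power2_eq_square algebra_simps)
  then show ?thesis using b by (simp add: field_simps)
qed

lemma sum_inverse_sqrt_le: "(\<Sum>r = 1..n. 1 / sqrt (real r)) \<le> 2 * sqrt (real n)"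
proof (induction n)
  case (Suc n)
  then show ?case using two_sqrt_step[of n] by simp
qed simp

lemma ln_le_sum_inverse:
  assumes K: "0 < (K :: real)"
  shows "ln ((K + 1 + real n) / (K + 1)) \<le> (\<Sum>r = 1..n. 1 / (K + real r))"
proof (induction n)
  case 0
  then show ?case using K by simp
next
  case (Suc n)
  define y where "y = K + real (Suc n)"
  have y: "0 < y" "K + 1 + real n = y" "K + 1 + real (Suc n) = y + 1"
    using K by (auto simp: y_def)
  have "1 + 1 / y = (y + 1) / y"
    using y by (simp add: field_simps)
  then have "(y + 1) / (K + 1) = y / (K + 1) * (1 + 1 / y)"
    using y by simp
  then have "ln ((y + 1) / (K + 1)) = ln (y / (K + 1) * (1 + 1 / y))"
    by (rule arg_cong)
  also have "\<dots> = ln (y / (K + 1)) + ln (1 + 1 / y)"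
    using y K by (intro ln_mult_pos divide_pos_pos add_pos_pos) auto
  also have "ln (1 + 1 / y) \<le> 1 / y"
    using y by (intro ln_add_one_self_le_self) simp
  finally show ?case using Suc unfolding y by (simp add: y_def)
qed

lemma quadratic_deriv: "deriv (\<lambda>y. \<epsilon> / 2 * y\<^sup>2) x = \<epsilon> * (x :: real)"
  by (rule DERIV_imp_deriv) (auto intro!: derivative_eq_intros)

lemma convex_quadratic: "0 \<le> \<epsilon> \<Longrightarrow> convex_on UNIV (\<lambda>y :: real. \<epsilon> / 2 * y\<^sup>2)"
  by (intro convex_on_cmul convex_power2) auto

lemma L_smooth_quadratic:
  assumes "0 \<le> \<epsilon>" "\<epsilon> \<le> L"
  shows "L_smooth L (\<lambda>y. \<epsilon> / 2 * y\<^sup>2)"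
proof -
  have "\<bar>\<epsilon> * x - \<epsilon> * y\<bar> \<le> L * \<bar>x - y\<bar>" for x y
    using assms by (simp add: right_diff_distrib[symmetric] abs_mult mult_right_mono)
  then show ?thesis
    unfolding L_smooth_def quadratic_deriv by (auto intro!: derivative_intros)
qed

section \<open>The coin oracle on a parabola\<close>

locale coin_oracle =
  fixes b0 \<eta> \<epsilon> s :: real
  assumes b0_pos: "0 < b0" and eta_pos: "0 < \<eta>" and eps_pos: "0 < \<epsilon>" and s_pos: "0 < s"
begin

text \<open>
  The answer at time \<open>t\<close> uses the iterate at time \<open>t\<close>, which is itself a function of the earlier
  answers. The cut-off \<open>r < t\<close> makes this a well-founded recursion; by \<open>answer_eq\<close> it does not
  change the iterate.
\<close>

fun answer :: "nat \<Rightarrow> (nat \<Rightarrow> real) \<Rightarrow> real" where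
  "answer t w =
     coin s (\<epsilon> * adagrad_norm b0 \<eta> 0 (\<lambda>r. if r < t then answer r w else 0) t) (w t)"

declare answer.simps [simp del]

abbreviation iterate :: "nat \<Rightarrow> (nat \<Rightarrow> real) \<Rightarrow> real" where
  "iterate t w \<equiv> adagrad_norm b0 \<eta> 0 (\<lambda>r. answer r w) t"

abbreviation filtration :: "nat \<Rightarrow> (nat \<Rightarrow> real) measure" where
  "filtration \<equiv> gradient_filtration uniform_sequence answer"

sublocale S: prob_space uniform_sequence
  by (rule prob_space_uniform_sequence)

lemma answer_eq: "answer t w = coin s (\<epsilon> * iterate t w) (w t)"
proof -
  have "adagrad_norm b0 \<eta> 0 (\<lambda>r. if r < t then answer r w else 0) t = iterate t w"
    by (rule adagrad_norm_cong) simp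
  then show ?thesis by (subst answer.simps) simp
qed

lemma answer_update: "r < t \<Longrightarrow> answer r (w(t := u)) = answer r w"
proof (induction r rule: less_induct)
  case (less r)
  have "iterate r (w(t := u)) = iterate r w"
    by (rule adagrad_norm_cong) (rule less.IH, use less.prems in simp_all)
  with less.prems show ?case
    by (simp add: answer_eq[of r] fun_upd_other del: fun_upd_apply)
qed

lemma iterate_update: "r \<le> t \<Longrightarrow> iterate r (w(t := u)) = iterate r w"
  by (rule adagrad_norm_cong) (simp add: answer_update)

lemma answer_measurable [measurable]: "answer t \<in> borel_measurable uniform_sequence"
proof (induction t rule: less_induct)
  case (less t)
  then have [measurable]: "iterate t \<in> borel_measurable uniform_sequence"
    by (intro adagrad_norm_measurable) auto
  have "answer t = (\<lambda>w. coin s (\<epsilon> * iterate t w) (w t))"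
    by (rule ext) (rule answer_eq)
  then show ?case by simp
qed

lemma iterate_measurable [measurable]: "iterate t \<in> borel_measurable uniform_sequence"
  by (rule adagrad_norm_measurable) simp

lemma iterate_predictable: "iterate t \<in> borel_measurable (filtration (t - 1))"
  by (intro adagrad_norm_measurable gradient_filtration_measurable) auto

lemma iterate_Suc:
  assumes "1 \<le> t"
  shows "iterate (Suc t) w =
    iterate t w - \<eta> * answer t w / norm_accumulator b0 (\<lambda>r. answer r w) t"
  using assms by simp

text \<open>
  The accumulator contains the current gradient, so no AdaGrad step is longer than \<open>\<eta>\<close>. This crude
  bound makes every iterate and every answer bounded, hence integrable, also after the horizon.
\<close>

lemma abs_answer_le_accumulator:
  assumes "1 \<le> t"
  shows "\<bar>answer t w\<bar> \<le> norm_accumulator b0 (\<lambda>r. answer r w) t"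
proof -
  have "(answer t w)\<^sup>2 \<le> (\<Sum>r = 1..t. (norm (answer r w))\<^sup>2)"
    using assms member_le_sum[of t "{1..t}" "\<lambda>r. (norm (answer r w))\<^sup>2"] by simp
  then have "(answer t w)\<^sup>2 \<le> b0\<^sup>2 + (\<Sum>r = 1..t. (norm (answer r w))\<^sup>2)"
    by (smt (verit) zero_le_power2)
  then have "sqrt ((answer t w)\<^sup>2) \<le> norm_accumulator b0 (\<lambda>r. answer r w) t"
    unfolding norm_accumulator_def by (rule real_sqrt_le_mono)
  then show ?thesis by simp
qed

lemma iterate_bounded: "\<bar>iterate t w\<bar> \<le> \<eta> * real t"
proof (induction t)
  case (Suc t)
  show ?case
  proof (cases "t = 0")
    case False
    let ?b = "norm_accumulator b0 (\<lambda>r. answer r w) t"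
    have "\<bar>answer t w\<bar> \<le> ?b"
      using False by (intro abs_answer_le_accumulator) simp
    then have "\<bar>answer t w / ?b\<bar> \<le> 1"
      using norm_accumulator_pos[OF b0_pos, of "\<lambda>r. answer r w" t] by (simp add: abs_divide)
    then have "\<bar>\<eta> * (answer t w / ?b)\<bar> \<le> \<eta> * 1"
      unfolding abs_mult using eta_pos by (intro mult_mono) auto
    moreover have "iterate (Suc t) w = iterate t w - \<eta> * (answer t w / ?b)"
      using False by (subst iterate_Suc) auto
    moreover have "\<eta> * real (Suc t) = \<eta> * real t + \<eta> * 1"
      by (simp add: algebra_simps)
    ultimately show ?thesis using Suc by linarith
  qed (use eta_pos in simp)
qed simp

lemma answer_bounded: "\<bar>answer t w\<bar> \<le> s + \<epsilon> * (\<eta> * real t)"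
proof -
  have "\<bar>answer t w\<bar> \<le> s + \<bar>\<epsilon> * iterate t w\<bar>"
    by (subst answer_eq) (rule coin_abs_le[OF s_pos])
  also have "\<bar>\<epsilon> * iterate t w\<bar> \<le> \<epsilon> * (\<eta> * real t)"
    unfolding abs_mult using eps_pos iterate_bounded by (intro mult_mono) auto
  finally show ?thesis by simp
qed

lemma integrable_answer: "integrable uniform_sequence (answer t)"
  by (rule S.integrable_const_bound[where B = "s + \<epsilon> * (\<eta> * real t)"])
    (auto simp: answer_bounded)

lemma integrable_iterate: "integrable uniform_sequence (iterate t)"
  by (rule S.integrable_const_bound[where B = "\<eta> * real t"])
    (auto simp: iterate_bounded)

lemma integrable_iterate_mult: "integrable uniform_sequence (\<lambda>w. iterate r w * iterate t w)"
proof (rule S.integrable_const_bound[where B = "(\<eta> * real r) * (\<eta> * real t)"])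
  show "AE w in uniform_sequence. norm (iterate r w * iterate t w) \<le> (\<eta> * real r) * (\<eta> * real t)"
    using iterate_bounded eta_pos by (auto simp: abs_mult intro!: mult_mono)
qed measurable

lemma integrable_iterate_mult_answer:
  "integrable uniform_sequence (\<lambda>w. iterate r w * answer t w)"
proof (rule S.integrable_const_bound[where B = "(\<eta> * real r) * (s + \<epsilon> * (\<eta> * real t))"])
  show "AE w in uniform_sequence.
      norm (iterate r w * answer t w) \<le> (\<eta> * real r) * (s + \<epsilon> * (\<eta> * real t))"
    using iterate_bounded answer_bounded eta_pos by (auto simp: abs_mult intro!: mult_mono)
qed measurable

text \<open>
  The martingale property: given the past, the answer may be replaced by its mean. Redrawing the
  variable of time \<open>t\<close> fixes \<open>h\<close> and the iterate, and only the coin is averaged. With \<open>h\<close> the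
  indicator of a past event this is the conditional expectation; with \<open>h\<close> an earlier iterate it
  drives the moment recursions.
\<close>

lemma integral_mult_answer:
  assumes [measurable]: "h \<in> borel_measurable uniform_sequence"
    and bounded: "\<And>w. \<bar>h w\<bar> \<le> B"
    and past: "\<And>w u. h (w(t := u)) = h w"
  shows "(\<integral>w. h w * answer t w \<partial>uniform_sequence) =
    (\<integral>w. h w * (\<epsilon> * iterate t w) \<partial>uniform_sequence)"
proof -
  have "0 \<le> B" using bounded[of undefined] by linarith
  then have "\<bar>h w * answer t w\<bar> \<le> B * (s + \<epsilon> * (\<eta> * real t))" for w
    unfolding abs_mult using bounded answer_bounded by (intro mult_mono) auto
  then have "(\<integral>w. h w * answer t w \<partial>uniform_sequence) =
      (\<integral>w. (\<integral>u. h (w(t := u)) * answer t (w(t := u)) \<partial>uniform01) \<partial>uniform_sequence)"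
    by (intro integral_resample) measurable
  also have "\<dots> = (\<integral>w. (\<integral>u. h w * coin s (\<epsilon> * iterate t w) u \<partial>uniform01) \<partial>uniform_sequence)"
    by (simp add: past answer_eq[of t "_(t := _)"] iterate_update)
  also have "\<dots> = (\<integral>w. h w * (\<epsilon> * iterate t w) \<partial>uniform_sequence)"
    using s_pos by (simp add: coin_mean)
  finally show ?thesis .
qed

lemma finite_measure_subalgebra_filtration:
  "finite_measure_subalgebra uniform_sequence (filtration t)"
  by (intro finite_measure_subalgebra.intro finite_measure_subalgebra_axioms.intro
    subalgebra_gradient_filtration answer_measurable) unfold_locales

lemma cond_exp_answer:
  assumes "1 \<le> t"
  shows "AE w in uniform_sequence.
    real_cond_exp uniform_sequence (filtration (t - 1)) (answer t) w = \<epsilon> * iterate t w"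
proof -
  interpret F: finite_measure_subalgebra uniform_sequence "filtration (t - 1)"
    by (rule finite_measure_subalgebra_filtration)
  show ?thesis
  proof (rule F.real_cond_exp_charact)
    fix A assume A: "A \<in> sets (filtration (t - 1))"
    then have [measurable]: "A \<in> sets uniform_sequence"
      using F.subalg by (auto simp: subalgebra_def)
    have "w(t := u) \<in> A \<longleftrightarrow> w \<in> A" for w u
      by (rule gradient_filtration_invariant[OF A]) (use assms in \<open>auto intro: answer_update\<close>)
    then have "(\<integral>w. indicator A w * answer t w \<partial>uniform_sequence) =
        (\<integral>w. indicator A w * (\<epsilon> * iterate t w) \<partial>uniform_sequence)"
      by (intro integral_mult_answer[where B = 1]) (auto simp: indicator_def)
    then show "(\<integral>w\<in>A. answer t w \<partial>uniform_sequence) =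
        (\<integral>w\<in>A. \<epsilon> * iterate t w \<partial>uniform_sequence)"
      by (simp only: set_lebesgue_integral_def real_scaleR_def)
  next
    show "(\<lambda>w. \<epsilon> * iterate t w) \<in> borel_measurable (filtration (t - 1))"
      using iterate_predictable[of t] by simp
  qed (auto intro: integrable_answer integrable_iterate)
qed

text \<open>
  The noise is bounded by \<open>\<sigma>\<close>, so the exponential is at most \<open>e\<close> already before conditioning.
\<close>

lemma cond_exp_noise_le:
  assumes sigma: "2 * s \<le> \<sigma>"
  shows "AE w in uniform_sequence. nn_cond_exp uniform_sequence (filtration n)
    (\<lambda>w. ennreal (exp ((answer t w - \<epsilon> * iterate t w)\<^sup>2 / \<sigma>\<^sup>2))) w \<le> ennreal (exp 1)"
proof -
  interpret F: finite_measure_subalgebra uniform_sequence "filtration n"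
    by (rule finite_measure_subalgebra_filtration)
  have "(answer t w - \<epsilon> * iterate t w)\<^sup>2 \<le> \<sigma>\<^sup>2" for w
    unfolding abs_le_square_iff[symmetric] answer_eq[of t w]
    using coin_noise_le[OF s_pos, of "\<epsilon> * iterate t w" "w t"] sigma s_pos by simp
  then have "ennreal (exp ((answer t w - \<epsilon> * iterate t w)\<^sup>2 / \<sigma>\<^sup>2)) \<le> ennreal (exp 1)" for w
    using sigma s_pos by (intro ennreal_leI) (simp add: divide_le_eq_1)
  then have "AE w in uniform_sequence. nn_cond_exp uniform_sequence (filtration n)
      (\<lambda>w. ennreal (exp ((answer t w - \<epsilon> * iterate t w)\<^sup>2 / \<sigma>\<^sup>2))) w
      \<le> nn_cond_exp uniform_sequence (filtration n) (\<lambda>_. ennreal (exp 1)) w"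
    by (intro F.nn_cond_exp_mono) auto
  moreover have "AE w in uniform_sequence.
      ennreal (exp 1) = nn_cond_exp uniform_sequence (filtration n) (\<lambda>_. ennreal (exp 1)) w"
    by (rule F.nn_cond_exp_F_meas) simp
  ultimately show ?thesis by eventually_elim simp
qed

lemma subgaussian_oracle_answer:
  assumes "2 * s \<le> \<sigma>"
  shows "subgaussian_oracle uniform_sequence (\<lambda>y. \<epsilon> / 2 * y\<^sup>2) \<sigma> iterate answer"
  unfolding subgaussian_oracle_def quadratic_deriv
  using integrable_answer cond_exp_answer cond_exp_noise_le[OF assms] by auto

end

section \<open>Deterministic accumulator up to the horizon\<close>

text \<open>
  Up to the horizon the curvature \<open>\<epsilon>\<close> is so small that the total pull towards the minimum is at most
  \<open>1 / 4\<close> (\<open>sum_contraction_le\<close>) and that the coin never needs a bias beyond its range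
  (\<open>horizon_deterministic\<close>).
\<close>

locale coin_oracle_horizon = coin_oracle +
  fixes T :: nat
  assumes horizon: "8 * \<eta> * \<epsilon> * sqrt (real T) \<le> s"
begin

text \<open>
  The value of \<open>b\<^sub>t\<close> on every path if all answers up to \<open>t\<close> are \<open>s\<close> or \<open>- s\<close>.
\<close>

definition accumulator :: "nat \<Rightarrow> real" where
  "accumulator t = sqrt (b0\<^sup>2 + real t * s\<^sup>2)"

definition contraction :: "nat \<Rightarrow> real" where
  "contraction t = \<eta> * \<epsilon> / accumulator t"

lemma accumulator_pos: "0 < accumulator t"
  unfolding accumulator_def using b0_pos by (intro real_sqrt_gt_zero add_pos_nonneg) auto

lemma accumulator_ge: "s * sqrt (real t) \<le> accumulator t"
proof -
  have "s * sqrt (real t) = sqrt (real t * s\<^sup>2)"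
    using s_pos by (simp add: real_sqrt_mult)
  also have "\<dots> \<le> accumulator t" unfolding accumulator_def by simp
  finally show ?thesis .
qed

lemma contraction_nonneg: "0 \<le> contraction t"
  unfolding contraction_def using accumulator_pos[of t] eta_pos eps_pos by simp

lemma sum_contraction_le:
  assumes "n \<le> T"
  shows "(\<Sum>r = 1..n. contraction r) \<le> 1 / 4"
proof -
  have "contraction r \<le> \<eta> * \<epsilon> / s * (1 / sqrt (real r))" if "1 \<le> r" for r
  proof -
    have "\<eta> * \<epsilon> / accumulator r \<le> \<eta> * \<epsilon> / (s * sqrt (real r))"
      using that accumulator_ge[of r] s_pos eta_pos eps_pos accumulator_pos[of r]
      by (intro divide_left_mono mult_pos_pos) auto
    then show ?thesis by (simp add: contraction_def)
  qed
  then have "(\<Sum>r = 1..n. contraction r) \<le> (\<Sum>r = 1..n. \<eta> * \<epsilon> / s * (1 / sqrt (real r)))"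
    by (intro sum_mono) auto
  also have "\<dots> = \<eta> * \<epsilon> / s * (\<Sum>r = 1..n. 1 / sqrt (real r))"
    by (simp add: sum_distrib_left)
  also have "\<dots> \<le> \<eta> * \<epsilon> / s * (2 * sqrt (real T))"
    using sum_inverse_sqrt_le[of n] assms s_pos eta_pos eps_pos
    by (intro mult_left_mono) (auto intro: order_trans)
  also have "\<dots> \<le> 1 / 4"
    using horizon s_pos by (simp add: field_simps)
  finally show ?thesis .
qed

text \<open>
  The three claims support each other: small iterates keep the coin in its range, coin answers make
  the accumulator grow like \<open>s * sqrt t\<close>, and this makes the steps at most \<open>\<eta> / sqrt t\<close>, whose sum
  keeps the iterates small. The index \<open>t - 1\<close> counts the steps taken before \<open>x\<^sub>t\<close>.
\<close>

lemma horizon_deterministic: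
  assumes "1 \<le> t" "t \<le> T"
  shows "\<bar>iterate t w\<bar> \<le> 2 * \<eta> * sqrt (real (t - 1)) \<and>
    (answer t w)\<^sup>2 = s\<^sup>2 \<and> norm_accumulator b0 (\<lambda>r. answer r w) t = accumulator t"
  using assms
proof (induction t rule: less_induct)
  case (less t)
  have small: "\<bar>iterate t w\<bar> \<le> 2 * \<eta> * sqrt (real (t - 1))"
  proof (cases "t = 1")
    case True
    then show ?thesis by simp
  next
    case False
    then obtain k where k: "t = Suc (Suc k)"
      using less.prems by (metis One_nat_def Suc_le_D not0_implies_Suc)
    let ?n = "Suc k"
    have IH: "\<bar>iterate ?n w\<bar> \<le> 2 * \<eta> * sqrt (real k)" "(answer ?n w)\<^sup>2 = s\<^sup>2"
      "norm_accumulator b0 (\<lambda>r. answer r w) ?n = accumulator ?n"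
      using less.IH[of ?n] less.prems k by auto
    have "\<bar>answer ?n w\<bar> = s"
      using IH(2) s_pos by (metis abs_of_pos abs_of_nonneg real_sqrt_abs)
    then have "\<bar>\<eta> * answer ?n w / accumulator ?n\<bar> = \<eta> * (s / accumulator ?n)"
      using eta_pos accumulator_pos[of ?n] by (simp add: abs_mult)
    also have "\<dots> \<le> \<eta> * (1 / sqrt (real ?n))"
    proof -
      have "s / accumulator ?n \<le> s / (s * sqrt (real ?n))"
        using accumulator_ge[of ?n] s_pos accumulator_pos[of ?n]
        by (intro divide_left_mono mult_pos_pos) auto
      then have "s / accumulator ?n \<le> 1 / sqrt (real ?n)" using s_pos by simp
      then show ?thesis using eta_pos by (intro mult_left_mono) auto
    qed
    finally have step: "\<bar>\<eta> * answer ?n w / accumulator ?n\<bar> \<le> \<eta> * (1 / sqrt (real ?n))" .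
    have "iterate t w = iterate ?n w - \<eta> * answer ?n w / accumulator ?n"
      using iterate_Suc[of ?n w] IH(3) unfolding k by simp
    with IH(1) step have "\<bar>iterate t w\<bar> \<le> 2 * \<eta> * sqrt (real k) + \<eta> * (1 / sqrt (real ?n))"
      by linarith
    also have "\<dots> = \<eta> * (2 * sqrt (real k) + 1 / sqrt (real ?n))"
      by (simp add: algebra_simps)
    also have "\<dots> \<le> \<eta> * (2 * sqrt (real ?n))"
      using two_sqrt_step[of k] eta_pos by (intro mult_left_mono) auto
    finally show ?thesis by (simp add: k)
  qed
  have "2 * \<eta> * sqrt (real (t - 1)) \<le> 2 * \<eta> * sqrt (real T)"
    using less.prems eta_pos by (intro mult_left_mono) auto
  then have "\<epsilon> * \<bar>iterate t w\<bar> \<le> \<epsilon> * (2 * \<eta> * sqrt (real T))"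
    using small eps_pos by (intro mult_left_mono) auto
  also have "\<dots> \<le> 8 * \<eta> * \<epsilon> * sqrt (real T)"
    using eta_pos eps_pos by simp
  finally have "\<bar>\<epsilon> * iterate t w\<bar> \<le> s"
    using horizon eps_pos unfolding abs_mult by linarith
  then have sq: "(answer t w)\<^sup>2 = s\<^sup>2"
    by (subst answer_eq) (rule coin_square)
  have "(\<Sum>r = 1..t. (norm (answer r w))\<^sup>2) = (\<Sum>r = 1..t. s\<^sup>2)"
    using less sq by (intro sum.cong) (auto simp: le_less)
  then have "norm_accumulator b0 (\<lambda>r. answer r w) t = accumulator t"
    by (simp add: norm_accumulator_def accumulator_def)
  with small sq show ?case by simp
qed

lemma answer_square: "1 \<le> t \<Longrightarrow> t \<le> T \<Longrightarrow> (answer t w)\<^sup>2 = s\<^sup>2"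
  using horizon_deterministic by blast

lemma iterate_step:
  assumes "1 \<le> t" "t \<le> T"
  shows "iterate (Suc t) w = iterate t w - \<eta> / accumulator t * answer t w"
  using assms iterate_Suc[of t w] horizon_deterministic[of t w] by simp

section \<open>Second moments of the iterates\<close>

definition correlation :: "nat \<Rightarrow> nat \<Rightarrow> real" where
  "correlation r t = (\<integral>w. iterate r w * iterate t w \<partial>uniform_sequence)"

lemma integral_iterate_mult_answer:
  assumes "r \<le> t"
  shows "(\<integral>w. iterate r w * answer t w \<partial>uniform_sequence) = \<epsilon> * correlation r t"
proof -
  have "(\<integral>w. iterate r w * answer t w \<partial>uniform_sequence) =
      (\<integral>w. iterate r w * (\<epsilon> * iterate t w) \<partial>uniform_sequence)"
    by (rule integral_mult_answer[where B = "\<eta> * real r"])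
      (use assms in \<open>auto simp: iterate_bounded intro: iterate_update\<close>)
  also have "\<dots> = (\<integral>w. \<epsilon> * (iterate r w * iterate t w) \<partial>uniform_sequence)"
    by (simp only: mult.left_commute)
  finally show ?thesis by (simp add: correlation_def)
qed

lemma correlation_Suc:
  assumes "r \<le> t" "1 \<le> t" "t \<le> T"
  shows "correlation r (Suc t) = (1 - contraction t) * correlation r t"
proof -
  have "correlation r (Suc t) = (\<integral>w. iterate r w * iterate t w
      - \<eta> / accumulator t * (iterate r w * answer t w) \<partial>uniform_sequence)"
    unfolding correlation_def iterate_step[OF assms(2,3)]
    by (intro Bochner_Integration.integral_cong) (auto simp: algebra_simps)
  also have "\<dots> = correlation r t - \<eta> / accumulator t * (\<epsilon> * correlation r t)"
    by (subst Bochner_Integration.integral_diff)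
      (auto simp only: integral_mult_right_zero integral_iterate_mult_answer[OF assms(1)]
        correlation_def[symmetric]
        intro!: integrable_iterate_mult integrable_mult_right integrable_iterate_mult_answer)
  finally show ?thesis by (simp add: contraction_def algebra_simps)
qed

lemma second_moment_Suc:
  assumes "1 \<le> t" "t \<le> T"
  shows "correlation (Suc t) (Suc t) =
    (1 - 2 * contraction t) * correlation t t + \<eta>\<^sup>2 * s\<^sup>2 / (accumulator t)\<^sup>2"
proof -
  have square: "iterate (Suc t) w * iterate (Suc t) w =
      iterate t w * iterate t w - 2 * \<eta> / accumulator t * (iterate t w * answer t w)
      + \<eta>\<^sup>2 * s\<^sup>2 / (accumulator t)\<^sup>2" for w
  proof -
    have "iterate (Suc t) w * iterate (Suc t) w =
        iterate t w * iterate t w - 2 * \<eta> / accumulator t * (iterate t w * answer t w)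
        + (\<eta> / accumulator t)\<^sup>2 * (answer t w)\<^sup>2"
      unfolding iterate_step[OF assms] by (simp add: power2_eq_square algebra_simps)
    then show ?thesis unfolding answer_square[OF assms] by (simp add: power_divide)
  qed
  have "correlation (Suc t) (Suc t) = correlation t t - 2 * \<eta> / accumulator t * (\<epsilon> * correlation t t)
      + \<eta>\<^sup>2 * s\<^sup>2 / (accumulator t)\<^sup>2"
  proof -
    have int: "integrable uniform_sequence (\<lambda>w. iterate t w * iterate t w)"
      "integrable uniform_sequence (\<lambda>w. 2 * \<eta> / accumulator t * (iterate t w * answer t w))"
      by (intro integrable_iterate_mult integrable_mult_right integrable_iterate_mult_answer)+
    have "correlation (Suc t) (Suc t) = (\<integral>w. (iterate t w * iterate t w
        - 2 * \<eta> / accumulator t * (iterate t w * answer t w)) + \<eta>\<^sup>2 * s\<^sup>2 / (accumulator t)\<^sup>2 \<partial>uniform_sequence)"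
      unfolding correlation_def square ..
    also have "\<dots> = (\<integral>w. iterate t w * iterate t w
        - 2 * \<eta> / accumulator t * (iterate t w * answer t w) \<partial>uniform_sequence)
        + (\<integral>w. \<eta>\<^sup>2 * s\<^sup>2 / (accumulator t)\<^sup>2 \<partial>uniform_sequence)"
      by (rule Bochner_Integration.integral_add[OF Bochner_Integration.integrable_diff[OF int]]) simp
    also have "(\<integral>w. iterate t w * iterate t w
        - 2 * \<eta> / accumulator t * (iterate t w * answer t w) \<partial>uniform_sequence) =
        correlation t t - 2 * \<eta> / accumulator t * (\<epsilon> * correlation t t)"
      unfolding Bochner_Integration.integral_diff[OF int] integral_mult_right_zero
        integral_iterate_mult_answer[OF order_refl] correlation_def[symmetric] ..
    finally show ?thesis using S.prob_space by simp
  qed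
  then show ?thesis by (simp add: contraction_def algebra_simps)
qed

lemma correlation_diagonal_nonneg: "0 \<le> correlation t t"
  unfolding correlation_def by (rule integral_nonneg_AE) simp

text \<open>
  Unrolling the recursion multiplies each injected variance \<open>\<eta>\<^sup>2 s\<^sup>2 / b\<^sub>r\<^sup>2\<close> by a product of factors
  \<open>1 - 2 * contraction i\<close>, and such a product is at least one minus the sum of the
  \<open>2 * contraction i\<close>.
\<close>

lemma second_moment_ge:
  assumes "n \<le> T"
  shows "(1 - 2 * (\<Sum>r = 1..n. contraction r)) * (\<Sum>r = 1..n. \<eta>\<^sup>2 * s\<^sup>2 / (accumulator r)\<^sup>2)
    \<le> correlation (Suc n) (Suc n)"
  using assms
proof (induction n)
  case 0
  then show ?case by (simp add: correlation_diagonal_nonneg)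
next
  case (Suc n)
  define A where "A = (\<Sum>r = 1..n. contraction r)"
  define a where "a = contraction (Suc n)"
  define Q where "Q = (\<Sum>r = 1..n. \<eta>\<^sup>2 * s\<^sup>2 / (accumulator r)\<^sup>2)"
  define q where "q = \<eta>\<^sup>2 * s\<^sup>2 / (accumulator (Suc n))\<^sup>2"
  have nonneg: "0 \<le> A" "0 \<le> a" "0 \<le> Q" "0 \<le> q"
    unfolding A_def a_def Q_def q_def by (auto intro!: sum_nonneg contraction_nonneg)
  have "A + a \<le> 1 / 4"
    using sum_contraction_le[OF Suc.prems] by (simp add: A_def a_def)
  have "(1 - 2 * (A + a)) * (Q + q) \<le> (1 - 2 * a) * ((1 - 2 * A) * Q) + q"
  proof -
    have "0 \<le> 4 * a * A * Q + 2 * (A + a) * q"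
      using nonneg by (intro add_nonneg_nonneg mult_nonneg_nonneg) auto
    then show ?thesis by (simp add: algebra_simps)
  qed
  also have "(1 - 2 * a) * ((1 - 2 * A) * Q) \<le> (1 - 2 * a) * correlation (Suc n) (Suc n)"
    using Suc nonneg \<open>A + a \<le> 1 / 4\<close> by (intro mult_left_mono) (auto simp: A_def Q_def)
  also have "(1 - 2 * a) * correlation (Suc n) (Suc n) + q = correlation (Suc (Suc n)) (Suc (Suc n))"
    using Suc.prems by (subst (2) second_moment_Suc) (auto simp: a_def q_def)
  finally show ?case by (simp add: A_def a_def Q_def q_def)
qed

text \<open>
  Later iterates remember earlier ones: between \<open>r\<close> and \<open>t\<close> the pull removes at most the fraction
  \<open>1 / 4\<close> of the correlation.
\<close>

lemma correlation_ge:
  assumes "1 \<le> r" "r \<le> t" "t \<le> T"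
  shows "3 / 4 * correlation r r \<le> correlation r t"
proof -
  have "(1 - (\<Sum>i = r..<t. contraction i)) * correlation r r \<le> correlation r t"
    using assms(2,3)
  proof (induction t rule: dec_induct)
    case base
    then show ?case by simp
  next
    case (step n)
    define A where "A = (\<Sum>i = r..<n. contraction i)"
    define a where "a = contraction n"
    define v where "v = correlation r r"
    have v: "0 \<le> v" unfolding v_def by (rule correlation_diagonal_nonneg)
    have nonneg: "0 \<le> A" "0 \<le> a"
      unfolding A_def a_def by (auto intro!: sum_nonneg contraction_nonneg)
    have "a \<le> (\<Sum>i = 1..n. contraction i)"
      unfolding a_def using step assms(1) by (intro member_le_sum contraction_nonneg) auto
    also have "\<dots> \<le> 1 / 4" using step by (intro sum_contraction_le) simp
    finally have "a \<le> 1" by simp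
    have "(1 - (A + a)) * v \<le> (1 - a) * ((1 - A) * v)"
    proof -
      have "0 \<le> a * A * v" using nonneg v by simp
      then show ?thesis by (simp add: algebra_simps)
    qed
    also have "\<dots> \<le> (1 - a) * correlation r n"
      using step \<open>a \<le> 1\<close> by (intro mult_left_mono) (auto simp: A_def v_def)
    also have "\<dots> = correlation r (Suc n)"
      using step assms(1) by (subst correlation_Suc) (auto simp: a_def)
    finally show ?case using step by (simp add: A_def a_def v_def)
  qed
  moreover have "(\<Sum>i = r..<t. contraction i) \<le> (\<Sum>i = 1..T. contraction i)"
    using assms by (intro sum_mono2 contraction_nonneg) auto
  then have "(\<Sum>i = r..<t. contraction i) \<le> 1 / 4"
    using sum_contraction_le[of T] by simp
  then have "3 / 4 * correlation r r \<le> (1 - (\<Sum>i = r..<t. contraction i)) * correlation r r"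
    by (intro mult_right_mono correlation_diagonal_nonneg) simp
  ultimately show ?thesis by linarith
qed

lemma correlation_commute: "correlation r t = correlation t r"
  unfolding correlation_def by (simp only: mult.commute)

section \<open>The averaged iterate\<close>

abbreviation average :: "(nat \<Rightarrow> real) \<Rightarrow> real" where
  "average w \<equiv> uniform_average (\<lambda>t. iterate t w) T"

lemma average_eq: "average w = (\<Sum>t = 1..T. iterate t w) / real T"
  by (simp add: uniform_average_def)

lemma integrable_average_mult_iterate:
  "integrable uniform_sequence (\<lambda>w. average w * iterate m w)"
  unfolding average_eq sum_divide_distrib sum_distrib_right times_divide_eq_left
  by (intro Bochner_Integration.integrable_sum integrable_divide integrable_iterate_mult)

lemma integrable_average_square: "integrable uniform_sequence (\<lambda>w. (average w)\<^sup>2)"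
proof -
  have "(average w)\<^sup>2 = (\<Sum>t = 1..T. average w * iterate t w) / real T" for w
    unfolding power2_eq_square sum_distrib_left[symmetric] by (subst (2) average_eq) simp
  then show ?thesis
    by (auto intro!: integrable_divide integrable_sum integrable_average_mult_iterate)
qed

lemma integral_average_mult_iterate:
  "(\<integral>w. average w * iterate m w \<partial>uniform_sequence) = (\<Sum>t = 1..T. correlation t m) / real T"
  unfolding average_eq correlation_def sum_divide_distrib sum_distrib_right times_divide_eq_left
  by (subst Bochner_Integration.integral_sum) (auto intro!: integrable_divide integrable_iterate_mult)

text \<open>
  Testing the average against the single iterate \<open>x\<^sub>m\<close> avoids the double sum of all correlations:
  from \<open>(y - x\<^sub>m / 2)\<^sup>2 \<ge> 0\<close> one gets \<open>E y\<^sup>2 \<ge> E (y * x\<^sub>m) - E x\<^sub>m\<^sup>2 / 4\<close>. For the average \<open>y\<close>, the later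
  half of the iterates contributes at least \<open>3 / 8 * E x\<^sub>m\<^sup>2\<close> to \<open>E (y * x\<^sub>m)\<close>, and the earlier ones
  contribute a nonnegative amount.
\<close>

lemma average_second_moment_ge:
  assumes m: "m = Suc (T div 2)" and T: "1 \<le> T"
  shows "correlation m m / 8 \<le> (\<integral>w. (average w)\<^sup>2 \<partial>uniform_sequence)"
proof -
  define v where "v = correlation m m"
  have v: "0 \<le> v" unfolding v_def by (rule correlation_diagonal_nonneg)
  have "m \<le> T" using m T by simp
  have "real T / 2 * (3 / 4 * v) \<le> real (card {m..T}) * (3 / 4 * v)"
  proof (rule mult_right_mono)
    have "T \<le> 2 * card {m..T}" using m by simp
    then show "real T / 2 \<le> real (card {m..T})" by linarith
  qed (use v in simp)
  also have "\<dots> \<le> (\<Sum>t = m..T. correlation t m)"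
  proof -
    have "(\<Sum>t = m..T. 3 / 4 * v) \<le> (\<Sum>t = m..T. correlation t m)"
    proof (rule sum_mono)
      fix t assume "t \<in> {m..T}"
      then show "3 / 4 * v \<le> correlation t m"
        using correlation_ge[of m t] m by (simp add: v_def correlation_commute[of t])
    qed
    then show ?thesis by simp
  qed
  also have "\<dots> \<le> (\<Sum>t = 1..T. correlation t m)"
  proof (rule sum_mono2)
    fix t assume "t \<in> {1..T} - {m..T}"
    then have "3 / 4 * correlation t t \<le> correlation t m"
      using \<open>m \<le> T\<close> by (intro correlation_ge) auto
    then show "0 \<le> correlation t m"
      using correlation_diagonal_nonneg[of t] by linarith
  qed (use m in auto)
  finally have "3 / 8 * v \<le> (\<integral>w. average w * iterate m w \<partial>uniform_sequence)"
    unfolding integral_average_mult_iterate using T by (simp add: field_simps)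
  moreover have "(\<integral>w. average w * iterate m w - iterate m w * iterate m w / 4 \<partial>uniform_sequence)
      \<le> (\<integral>w. (average w)\<^sup>2 \<partial>uniform_sequence)"
  proof (rule integral_mono)
    fix w
    have "0 \<le> (average w - iterate m w / 2)\<^sup>2" by simp
    then show "average w * iterate m w - iterate m w * iterate m w / 4 \<le> (average w)\<^sup>2"
      by (simp add: power2_eq_square algebra_simps)
  qed (intro Bochner_Integration.integrable_diff integrable_divide integrable_average_mult_iterate
    integrable_iterate_mult integrable_average_square)+
  moreover have "(\<integral>w. average w * iterate m w - iterate m w * iterate m w / 4 \<partial>uniform_sequence)
      = (\<integral>w. average w * iterate m w \<partial>uniform_sequence) - v / 4"
    by (subst Bochner_Integration.integral_diff)
      (auto simp: v_def correlation_def
        intro!: integrable_divide integrable_average_mult_iterate integrable_iterate_mult)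
  ultimately show ?thesis unfolding v_def by linarith
qed

text \<open>
  The injected variances are \<open>\<eta>\<^sup>2 / (K + r)\<close> with \<open>K = b0\<^sup>2 / s\<^sup>2\<close>, a shifted harmonic sum. Its first
  \<open>T div 2\<close> terms reach half of \<open>ln T\<close> once \<open>sqrt T\<close> dominates the shift.
\<close>

lemma mid_second_moment_ge:
  assumes large: "2 * (b0\<^sup>2 / s\<^sup>2 + 1) \<le> sqrt (real T)"
  shows "\<eta>\<^sup>2 * ln (real T) / 4 \<le> correlation (Suc (T div 2)) (Suc (T div 2))"
proof -
  define K where "K = b0\<^sup>2 / s\<^sup>2"
  define n where "n = T div 2"
  define Q where "Q = (\<Sum>r = 1..n. \<eta>\<^sup>2 * s\<^sup>2 / (accumulator r)\<^sup>2)"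
  have K: "0 < K" using b0_pos s_pos by (simp add: K_def)
  have sqrtT: "2 * (K + 1) \<le> sqrt (real T)" using large by (simp add: K_def)
  then have T: "0 < sqrt (real T)" "0 < real T" using K by (smt (verit) real_sqrt_gt_0_iff)+
  have "real T / 2 \<le> K + 1 + real n"
    using K unfolding n_def by linarith
  have "sqrt (real T) * (2 * (K + 1)) \<le> sqrt (real T) * sqrt (real T)"
    using sqrtT by (intro mult_left_mono) auto
  then have "sqrt (real T) * (K + 1) \<le> real T / 2"
    by (simp add: algebra_simps)
  also note \<open>real T / 2 \<le> K + 1 + real n\<close>
  finally have "sqrt (real T) \<le> (K + 1 + real n) / (K + 1)"
    using K by (simp add: pos_le_divide_eq)
  then have "ln (sqrt (real T)) \<le> ln ((K + 1 + real n) / (K + 1))"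
    using T by (intro ln_mono) auto
  also have "\<dots> \<le> (\<Sum>r = 1..n. 1 / (K + real r))"
    by (rule ln_le_sum_inverse[OF K])
  finally have "ln (real T) / 2 \<le> (\<Sum>r = 1..n. 1 / (K + real r))"
    using T by (simp add: ln_sqrt)
  then have "\<eta>\<^sup>2 * (ln (real T) / 2) \<le> \<eta>\<^sup>2 * (\<Sum>r = 1..n. 1 / (K + real r))"
    by (intro mult_left_mono) auto
  also have "\<dots> = Q"
  proof -
    have "\<eta>\<^sup>2 * (1 / (K + real r)) = \<eta>\<^sup>2 * s\<^sup>2 / (accumulator r)\<^sup>2" for r
    proof -
      have "(accumulator r)\<^sup>2 = s\<^sup>2 * (K + real r)"
        using s_pos by (simp add: accumulator_def K_def algebra_simps)
      then show ?thesis using s_pos by simp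
    qed
    then show ?thesis by (simp add: Q_def sum_distrib_left)
  qed
  finally have Q: "\<eta>\<^sup>2 * (ln (real T) / 2) \<le> Q" .
  have "0 \<le> Q" unfolding Q_def by (intro sum_nonneg) auto
  have "n \<le> T" by (simp add: n_def)
  have "1 / 2 * Q \<le> (1 - 2 * (\<Sum>r = 1..n. contraction r)) * Q"
    using sum_contraction_le[OF \<open>n \<le> T\<close>] \<open>0 \<le> Q\<close> by (intro mult_right_mono) auto
  also have "\<dots> \<le> correlation (Suc n) (Suc n)"
    unfolding Q_def by (rule second_moment_ge[OF \<open>n \<le> T\<close>])
  finally show ?thesis using Q by (simp add: n_def)
qed

end

section \<open>The lower bound\<close>

theorem theorem3p10:
  shows "\<exists>c::real. c > 0 \<and>
    (\<forall>L \<sigma> b0 \<eta> :: real. L > 0 \<longrightarrow> \<sigma> > 0 \<longrightarrow> b0 > 0 \<longrightarrow> \<eta> > 0 \<longrightarrow>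
      (\<exists>T0::nat. \<forall>T\<ge>T0.
        \<exists>(f :: real \<Rightarrow> real) (M :: (nat \<Rightarrow> real) measure) (g :: nat \<Rightarrow> (nat \<Rightarrow> real) \<Rightarrow> real).
          convex_on UNIV f \<and> L_smooth L f \<and> f 0 = 0 \<and> (\<forall>y. f y \<ge> f 0) \<and>
          prob_space M \<and>
          (\<forall>alg \<in> {adagrad_norm b0 \<eta> 0, adagrad (\<lambda>_. b0) \<eta> 0}.
             let x = (\<lambda>t \<omega>. alg (\<lambda>s. g s \<omega>) t) in
               subgaussian_oracle M f \<sigma> x g \<and>
               integrable M (\<lambda>\<omega>. f (uniform_average (\<lambda>t. x t \<omega>) T)) \<and>
               (\<integral>\<omega>. (f (uniform_average (\<lambda>t. x t \<omega>) T) - f 0) \<partial>M)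
                 \<ge> c * \<eta> * \<sigma> * (ln (real T) / sqrt (real T)))))"
proof (intro exI[of _ "1 / 1024 :: real"] conjI allI impI)
  fix L \<sigma> b0 \<eta> :: real
  assume pos: "0 < L" "0 < \<sigma>" "0 < b0" "0 < \<eta>"
  define s where "s = \<sigma> / 2"
  \<comment> \<open>\<open>sqrt T \<ge> R\<close> gives \<open>\<epsilon> \<le> L\<close> by the first entry, and by the second the logarithm outweighs \<open>b0\<close>.\<close>
  define R where "R = max (\<sigma> / (16 * \<eta> * L)) (2 * (b0\<^sup>2 / s\<^sup>2 + 1))"
  have R: "0 < R" unfolding R_def by (simp add: less_max_iff_disj add_nonneg_pos)
  show "\<exists>T0::nat. \<forall>T\<ge>T0.
        \<exists>(f :: real \<Rightarrow> real) (M :: (nat \<Rightarrow> real) measure) (g :: nat \<Rightarrow> (nat \<Rightarrow> real) \<Rightarrow> real).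
          convex_on UNIV f \<and> L_smooth L f \<and> f 0 = 0 \<and> (\<forall>y. f y \<ge> f 0) \<and>
          prob_space M \<and>
          (\<forall>alg \<in> {adagrad_norm b0 \<eta> 0, adagrad (\<lambda>_. b0) \<eta> 0}.
             let x = (\<lambda>t w. alg (\<lambda>s. g s w) t) in
               subgaussian_oracle M f \<sigma> x g \<and>
               integrable M (\<lambda>w. f (uniform_average (\<lambda>t. x t w) T)) \<and>
               (\<integral>w. (f (uniform_average (\<lambda>t. x t w) T) - f 0) \<partial>M)
                 \<ge> 1 / 1024 * \<eta> * \<sigma> * (ln (real T) / sqrt (real T)))"
  proof (intro exI[of _ "nat \<lceil>R\<^sup>2\<rceil>"] allI impI)
    fix T :: nat
    assume "nat \<lceil>R\<^sup>2\<rceil> \<le> T"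
    then have "R\<^sup>2 \<le> real T" by linarith
    then have RT: "R \<le> sqrt (real T)" by (rule real_le_rsqrt)
    then have sqrtT: "0 < sqrt (real T)" using R by linarith
    then have T: "1 \<le> T" by simp
    define \<epsilon> where "\<epsilon> = \<sigma> / (16 * \<eta> * sqrt (real T))"
    have eps: "0 < \<epsilon>" using pos sqrtT by (simp add: \<epsilon>_def)
    have "\<epsilon> \<le> L"
    proof -
      have "\<sigma> / (16 * \<eta> * L) \<le> sqrt (real T)" using RT by (simp add: R_def)
      then show ?thesis using pos sqrtT by (simp add: \<epsilon>_def field_simps)
    qed
    interpret coin_oracle_horizon b0 \<eta> \<epsilon> s T
      using pos eps sqrtT by unfold_locales (auto simp: s_def \<epsilon>_def)
    let ?f = "\<lambda>y. \<epsilon> / 2 * y\<^sup>2"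
    have "\<eta>\<^sup>2 * ln (real T) / 4 \<le> correlation (Suc (T div 2)) (Suc (T div 2))"
      using RT by (intro mid_second_moment_ge) (simp add: R_def)
    also have "\<dots> \<le> 8 * (\<integral>w. (average w)\<^sup>2 \<partial>uniform_sequence)"
      using average_second_moment_ge[OF refl T] by simp
    finally have "\<epsilon> / 2 * (\<eta>\<^sup>2 * ln (real T) / 32) \<le>
        \<epsilon> / 2 * (\<integral>w. (average w)\<^sup>2 \<partial>uniform_sequence)"
      using eps by (intro mult_left_mono) auto
    moreover have "\<epsilon> / 2 * (\<eta>\<^sup>2 * ln (real T) / 32) =
        1 / 1024 * \<eta> * \<sigma> * (ln (real T) / sqrt (real T))"
      using pos sqrtT by (simp add: \<epsilon>_def power2_eq_square)
    moreover have "(\<integral>w. ?f (average w) - ?f 0 \<partial>uniform_sequence) =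
        \<epsilon> / 2 * (\<integral>w. (average w)\<^sup>2 \<partial>uniform_sequence)"
      by simp
    ultimately have gap: "1 / 1024 * \<eta> * \<sigma> * (ln (real T) / sqrt (real T)) \<le>
        (\<integral>w. ?f (average w) - ?f 0 \<partial>uniform_sequence)"
      by linarith
    have "\<forall>alg \<in> {adagrad_norm b0 \<eta> 0, adagrad (\<lambda>_. b0) \<eta> 0}.
             let x = (\<lambda>t w. alg (\<lambda>s. answer s w) t) in
               subgaussian_oracle uniform_sequence ?f \<sigma> x answer \<and>
               integrable uniform_sequence (\<lambda>w. ?f (uniform_average (\<lambda>t. x t w) T)) \<and>
               (\<integral>w. (?f (uniform_average (\<lambda>t. x t w) T) - ?f 0) \<partial>uniform_sequence)
                 \<ge> 1 / 1024 * \<eta> * \<sigma> * (ln (real T) / sqrt (real T))"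
      unfolding adagrad_eq_adagrad_norm Let_def
      using subgaussian_oracle_answer[of \<sigma>] integrable_average_square gap
      by (auto simp: s_def intro: integrable_mult_right)
    moreover have "convex_on UNIV ?f" "L_smooth L ?f"
      using eps \<open>\<epsilon> \<le> L\<close> convex_quadratic[of \<epsilon>] L_smooth_quadratic[of \<epsilon> L] by simp_all
    ultimately show "\<exists>(f :: real \<Rightarrow> real) (M :: (nat \<Rightarrow> real) measure)
          (g :: nat \<Rightarrow> (nat \<Rightarrow> real) \<Rightarrow> real).
          convex_on UNIV f \<and> L_smooth L f \<and> f 0 = 0 \<and> (\<forall>y. f y \<ge> f 0) \<and>
          prob_space M \<and>
          (\<forall>alg \<in> {adagrad_norm b0 \<eta> 0, adagrad (\<lambda>_. b0) \<eta> 0}.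
             let x = (\<lambda>t w. alg (\<lambda>s. g s w) t) in
               subgaussian_oracle M f \<sigma> x g \<and>
               integrable M (\<lambda>w. f (uniform_average (\<lambda>t. x t w) T)) \<and>
               (\<integral>w. (f (uniform_average (\<lambda>t. x t w) T) - f 0) \<partial>M)
                 \<ge> 1 / 1024 * \<eta> * \<sigma> * (ln (real T) / sqrt (real T)))"
      using eps prob_space_uniform_sequence
      by (intro exI[of _ ?f] exI[of _ uniform_sequence] exI[of _ answer]) auto
  qed
qed simp

end
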